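(* Let $\pi\colon\mathbb R^n\to U\subset G_k(n)$ be a skew fibration of $\mathbb R^n$ by oriented affine $k$-planes, and let $L=\bigcup_{u\in U}(u\cap S^{n-1})$. For $\ell\in L$ let $\iota(\ell)\in U$ denote the unique $u\in U$ containing $\ell$. Let $\ell\in L$, $u=\iota(\ell)$, and let $y_n\in\mathbb R^n$ be a sequence of points with $|y_n|\to\infty$ and $y_n/|y_n|\to\ell$. Then $\pi(y_n)\to u$ in $G_k(n)$.
   Context: A fibration of $\mathbb R^n$ by oriented affine $k$-planes is a family of pairwise disjoint oriented affine $k$-planes covering $\mathbb R^n$ such that the map sending a point to its fiber is continuous; $\pi(x)\in G_k(n)$ is the oriented linear $k$-plane parallel to the fiber through $x$, and $U=\pi(\mathbb R^n)$. The fibration is skew if no two distinct fibers contain parallel lines (so $\pi$ is injective on fibers and $\iota$ is well defined). $S^{n-1}$ is the unit sphere of $\mathbb R^n$, whose points are viewed as oriented directions. *)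

theory Defs
  imports "HOL-Analysis.Analysis"
begin

text \<open>Ambient space R^n is real^'n; k is encoded by a finite type 'k with CARD('k) = k.
A k-frame in R^n is an n x k real matrix M (columns = the frame vectors) with linearly
independent columns, i.e. the linear map x |-> M *v x is injective.
An oriented linear k-plane is the class of all frames of the same subspace that differ by a
change of basis with positive determinant.  G_k(n) is the set of all such classes.\<close>

definition frames :: "(real^'k^'n) set" where
  "frames = {M. inj ((*v) M)}"

definition oplane_of :: "real^'k^'n \<Rightarrow> (real^'k^'n) set" where
  "oplane_of M = {M ** A | A :: real^'k^'k. det A > 0}"

definition Grass :: "((real^'k^'n) set) set" where
  "Grass = oplane_of ` frames"

text \<open>Underlying linear subspace (the column space of any representing frame).\<close>
definition lin :: "(real^'k^'n) set \<Rightarrow> (real^'n) set" where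
  "lin u = (\<Union>M\<in>u. range ((*v) M))"

text \<open>Convergence in G_k(n) (quotient topology of the space of frames; sequences lift along
the open quotient map): some choice of representing frames converges.\<close>
definition gconv :: "(nat \<Rightarrow> (real^'k^'n) set) \<Rightarrow> (real^'k^'n) set \<Rightarrow> bool" where
  "gconv us u \<longleftrightarrow> (\<exists>Ms M. (\<forall>m. Ms m \<in> us m) \<and> M \<in> u \<and> Ms \<longlonglongrightarrow> M)"

text \<open>Given the direction map pi, the fiber through x is the oriented affine k-plane
(pi x, x + lin (pi x)).\<close>
definition affp :: "(real^'n \<Rightarrow> (real^'k^'n) set) \<Rightarrow> real^'n \<Rightarrow> (real^'n) set" where
  "affp \<pi> x = (\<lambda>v. x + v) ` lin (\<pi> x)"

definition fiber :: "(real^'n \<Rightarrow> (real^'k^'n) set) \<Rightarrow> real^'n \<Rightarrow> (real^'k^'n) set \<times> (real^'n) set" where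
  "fiber \<pi> x = (\<pi> x, affp \<pi> x)"

text \<open>Foot point (point of the affine plane closest to the origin); together with the
oriented direction it gives the standard coordinates on the space of oriented affine planes.\<close>
definition foot :: "(real^'n \<Rightarrow> (real^'k^'n) set) \<Rightarrow> real^'n \<Rightarrow> real^'n" where
  "foot \<pi> x = closest_point (affp \<pi> x) 0"

text \<open>Fibration of R^n by oriented affine k-planes, described by the map pi: the fibers
{fiber pi x} cover R^n (automatic: x lies in its fiber), are pairwise disjoint (two fibers that
meet coincide as oriented affine planes), and x |-> fiber through x is continuous
(sequentially, R^n being first countable).\<close>
definition fibration :: "(real^'n \<Rightarrow> (real^'k^'n) set) \<Rightarrow> bool" where
  "fibration \<pi> \<longleftrightarrow>
     (\<forall>x. \<pi> x \<in> Grass) \<and>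
     (\<forall>x y. affp \<pi> x \<inter> affp \<pi> y \<noteq> {} \<longrightarrow> fiber \<pi> x = fiber \<pi> y) \<and>
     (\<forall>xs x. xs \<longlonglongrightarrow> x \<longrightarrow>
        gconv (\<lambda>m. \<pi> (xs m)) (\<pi> x) \<and> (\<lambda>m. foot \<pi> (xs m)) \<longlonglongrightarrow> foot \<pi> x)"

text \<open>Skew: no two distinct fibers contain parallel lines.\<close>
definition skew_fibration :: "(real^'n \<Rightarrow> (real^'k^'n) set) \<Rightarrow> bool" where
  "skew_fibration \<pi> \<longleftrightarrow> fibration \<pi> \<and>
     (\<forall>x y. fiber \<pi> x \<noteq> fiber \<pi> y \<longrightarrow> lin (\<pi> x) \<inter> lin (\<pi> y) = {0})"

definition Lset :: "(real^'n \<Rightarrow> (real^'k^'n) set) \<Rightarrow> (real^'n) set" where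
  "Lset \<pi> = (\<Union>u\<in>range \<pi>. lin u \<inter> sphere 0 1)"

definition iota :: "(real^'n \<Rightarrow> (real^'k^'n) set) \<Rightarrow> real^'n \<Rightarrow> (real^'k^'n) set" where
  "iota \<pi> l = (THE u. u \<in> range \<pi> \<and> l \<in> lin u)"

end

theory Submission
  imports Defs
begin

text \<open>Let p lie on the fiber of direction u. The fibers through a small disc D around p, orthogonal
to that fiber, are graphs over it. Since the fibration is skew, the fibers through the boundary of D
diverge linearly from the fiber through p when one moves in direction l. Sliding D along the
fibers by a large vector s close in direction to l is therefore an injective continuous map sending
the boundary far away, so by invariance of domain its image contains a ball of radius proportional
to the norm of s. As the distance of \<open>y m\<close> to the fiber through p grows sublinearly, \<open>y m\<close>
eventually lies on a fiber through D; now shrink D and use the continuity of \<open>\<pi>\<close> at p.\<close>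

section \<open>Limits of matrix expressions\<close>

lemma tendsto_matrixI:
  fixes f :: "'b \<Rightarrow> real^'m^'n"
  assumes "\<And>i j. ((\<lambda>x. f x $ i $ j) \<longlongrightarrow> a $ i $ j) F"
  shows "(f \<longlongrightarrow> a) F"
  using assms by (intro vec_tendstoI)

lemma tendsto_matrix_mult:
  fixes f :: "'b \<Rightarrow> real^'m^'n" and g :: "'b \<Rightarrow> real^'k^'m"
  assumes "(f \<longlongrightarrow> a) F" "(g \<longlongrightarrow> b) F"
  shows "((\<lambda>x. f x ** g x) \<longlongrightarrow> a ** b) F"
  unfolding matrix_matrix_mult_def
  by (rule tendsto_matrixI) (auto intro!: tendsto_intros assms)

lemma tendsto_matrix_vector_mult:
  fixes f :: "'b \<Rightarrow> real^'m^'n" and g :: "'b \<Rightarrow> real^'m"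
  assumes "(f \<longlongrightarrow> a) F" "(g \<longlongrightarrow> b) F"
  shows "((\<lambda>x. f x *v g x) \<longlongrightarrow> a *v b) F"
  unfolding matrix_vector_mult_def
  by (rule vec_tendstoI) (auto intro!: tendsto_intros assms)

lemma tendsto_det:
  fixes f :: "'b \<Rightarrow> real^'n^'n"
  assumes "(f \<longlongrightarrow> a) F"
  shows "((\<lambda>x. det (f x)) \<longlongrightarrow> det a) F"
  unfolding det_def by (intro tendsto_intros assms)

lemma bounded_bilinear_matrix_vector_mult:
  "bounded_bilinear ((*v) :: real^'m^'n \<Rightarrow> real^'m \<Rightarrow> real^'n)"
proof -
  have "bilinear ((*v) :: real^'m^'n \<Rightarrow> real^'m \<Rightarrow> real^'n)"
    unfolding bilinear_def
    by (auto intro!: linearI simp: matrix_vector_mult_add_rdistrib matrix_vector_right_distrib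
        scaleR_matrix_vector_assoc matrix_vector_mult_scaleR)
  then show ?thesis
    by (simp add: bilinear_conv_bounded_bilinear)
qed

section \<open>Inverse matrices and sections of a linear projection\<close>

definition cramer_inv :: "real^'n^'n \<Rightarrow> real^'n^'n" where
  "cramer_inv A = (\<chi> k j. det (\<chi> i l. if l = k then axis j 1 $ i else A $ i $ l) / det A)"

lemma matrix_mult_cramer_inv:
  fixes A :: "real^'n^'n"
  assumes "det A \<noteq> 0"
  shows "A ** cramer_inv A = mat 1"
proof -
  have "(A ** cramer_inv A) $ i $ j = mat 1 $ i $ j" for i j
  proof -
    have "A *v column j (cramer_inv A) = axis j 1"
      unfolding cramer[OF assms] by (simp add: column_def cramer_inv_def)
    then have "(A *v column j (cramer_inv A)) $ i = axis j 1 $ i"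
      by simp
    then show ?thesis
      by (auto simp: matrix_matrix_mult_def matrix_vector_mult_def column_def mat_def axis_def)
  qed
  then show ?thesis
    by (simp add: vec_eq_iff)
qed

text \<open>This is why the inverse is given by Cramer's rule: its entries are quotients of
  determinants, hence continuous where the denominator does not vanish.\<close>

lemma tendsto_cramer_inv:
  fixes f :: "'b \<Rightarrow> real^'n^'n"
  assumes "(f \<longlongrightarrow> a) F" "det a \<noteq> 0"
  shows "((\<lambda>x. cramer_inv (f x)) \<longlongrightarrow> cramer_inv a) F"
proof (rule tendsto_matrixI)
  fix k j
  have "((\<lambda>x. \<chi> i l. if l = k then axis j 1 $ i else f x $ i $ l) \<longlongrightarrow>
      (\<chi> i l. if l = k then axis j 1 $ i else a $ i $ l)) F"
    by (rule tendsto_matrixI) (auto intro!: tendsto_intros assms)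
  then show "((\<lambda>x. cramer_inv (f x) $ k $ j) \<longlongrightarrow> cramer_inv a $ k $ j) F"
    unfolding cramer_inv_def by (auto intro!: tendsto_intros tendsto_det assms)
qed

text \<open>If P restricts to an isomorphism on the column space of M, this is the section of P with
values in that column space; it depends only on the column space.\<close>

definition col_section :: "real^'n^'k \<Rightarrow> real^'k^'n \<Rightarrow> real^'k^'n" where
  "col_section P M = M ** cramer_inv (P ** M)"

lemma col_section_in_range: "col_section P M *v s \<in> range ((*v) M)"
  by (simp add: col_section_def flip: matrix_vector_mul_assoc)

lemma mult_col_section:
  assumes "det (P ** M) \<noteq> 0"
  shows "P *v (col_section P M *v s) = s"
  by (simp add: col_section_def matrix_vector_mul_assoc matrix_mul_assoc
      matrix_mult_cramer_inv[OF assms])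

text \<open>For square matrices a right inverse is also a left inverse, so with
  \<open>w = M *v a\<close> the factor \<open>cramer_inv (P ** M)\<close> cancels
  \<open>P ** M\<close>.\<close>

lemma col_section_mult:
  assumes det: "det (P ** M) \<noteq> 0" and w: "w \<in> range ((*v) M)"
  shows "col_section P M *v (P *v w) = w"
proof -
  obtain a where a: "w = M *v a"
    using w by auto
  have "cramer_inv (P ** M) ** (P ** M) = mat 1"
    using matrix_mult_cramer_inv[OF det] matrix_left_right_inverse by blast
  then show ?thesis
    by (simp add: a col_section_def matrix_vector_mul_assoc) 
      (metis matrix_mul_assoc matrix_mul_rid)
qed

text \<open>The section of \<open>N\<close> takes values in the column space of \<open>M\<close>,
  where the section of \<open>M\<close> inverts \<open>P\<close>; so both agree.\<close>

lemma col_section_cong: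
  assumes "det (P ** M) \<noteq> 0" "det (P ** N) \<noteq> 0" "range ((*v) M) = range ((*v) N)"
  shows "col_section P M = col_section P N"
proof -
  have "col_section P M *v s = col_section P N *v s" for s
    using col_section_mult[OF assms(1), of "col_section P N *v s"]
    by (simp add: assms col_section_in_range mult_col_section)
  then show ?thesis
    by (simp add: matrix_eq)
qed

lemma tendsto_col_section:
  assumes "(f \<longlongrightarrow> M) F" "det (P ** M) \<noteq> 0"
  shows "((\<lambda>x. col_section P (f x)) \<longlongrightarrow> col_section P M) F"
  unfolding col_section_def
  by (intro tendsto_matrix_mult tendsto_cramer_inv tendsto_const assms)

text \<open>A kernel vector \<open>v\<close> of the Gram matrix satisfies
  \<open>(M *v v) \<bullet> (M *v v) = 0\<close>, so injectivity forces
  \<open>v = 0\<close>.\<close>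

lemma det_transpose_mult_self_nonzero:
  fixes M :: "real^'k^'n"
  assumes "inj ((*v) M)"
  shows "det (transpose M ** M) \<noteq> 0"
proof -
  have "v = 0" if "(transpose M ** M) *v v = 0" for v
  proof -
    have "(M *v v) \<bullet> (M *v v) = v \<bullet> ((transpose M ** M) *v v)"
      by (metis dot_lmul_matrix matrix_vector_mul_assoc vector_transpose_matrix
          transpose_transpose)
    then have "M *v v = M *v 0"
      using that by simp
    then show ?thesis
      using assms by (meson injD)
  qed
  then show ?thesis
    by (metis invertible_det_nz invertible_left_inverse matrix_left_invertible_ker)
qed

section \<open>Frames of an oriented plane\<close>

lemma det_pos_imp_right_inverse:
  fixes A :: "real^'k^'k"
  assumes "det A > 0"
  obtains B where "A ** B = mat 1"
  using assms by (metis less_irrefl matrix_mult_cramer_inv)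

lemma range_matrix_mult:
  fixes M :: "real^'k^'n" and A :: "real^'k^'k"
  assumes "det A > 0"
  shows "range ((*v) (M ** A)) = range ((*v) M)"
proof -
  obtain B where B: "A ** B = mat 1"
    using assms det_pos_imp_right_inverse by blast
  have "M *v v = (M ** A) *v (B *v v)" for v
    by (metis B matrix_mul_assoc matrix_mul_rid matrix_vector_mul_assoc)
  moreover have "(M ** A) *v v = M *v (A *v v)" for v
    by (simp add: matrix_vector_mul_assoc)
  ultimately show ?thesis
    by (auto simp: image_iff)
qed

lemma Grass_nonempty:
  assumes "u \<in> Grass"
  shows "u \<noteq> {}"
proof -
  have "det (mat 1 :: real^'k^'k) > 0"
    by simp
  then show ?thesis
    using assms unfolding Grass_def oplane_of_def by blast
qed

lemma Grass_range:
  assumes "u \<in> Grass" "M \<in> u"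
  shows "lin u = range ((*v) M)"
proof -
  obtain M0 where u: "u = oplane_of M0"
    using assms unfolding Grass_def by blast
  have "range ((*v) N) = range ((*v) M0)" if "N \<in> u" for N
    using that unfolding u oplane_of_def by (auto dest: range_matrix_mult[where M = M0])
  then show ?thesis
    using assms(2) unfolding lin_def by blast
qed

lemma Grass_inj:
  assumes "u \<in> Grass" "M \<in> u"
  shows "inj ((*v) M)"
proof -
  obtain M0 A where M0: "inj ((*v) M0)" and A: "det A > 0" "M = M0 ** A"
    using assms unfolding Grass_def oplane_of_def frames_def by blast
  have "inj ((*v) A)"
    by (metis A(1) inj_matrix_vector_mult invertible_det_nz less_irrefl)
  then have "inj ((*v) M0 \<circ> (*v) A)"
    using M0 by (rule inj_compose[rotated])
  moreover have "(*v) M0 \<circ> (*v) A = (*v) M"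
    by (auto simp: A matrix_vector_mul_assoc)
  ultimately show ?thesis by simp
qed

lemma subspace_lin: "u \<in> Grass \<Longrightarrow> subspace (lin u)"
  using Grass_nonempty[of u] Grass_range[of u]
  by (metis ex_in_conv linear_subspace_image matrix_vector_mul_linear subspace_UNIV)

text \<open>The image of the ball is open by invariance of domain and, the image of the sphere being
far away, also closed inside the ball of radius \<open>norm z\<close>.\<close>

lemma inj_ball_image_covers:
  fixes F :: "'a::euclidean_space \<Rightarrow> 'a"
  assumes V: "subspace V" and "r > 0"
    and cont: "continuous_on (V \<inter> cball 0 r) F" and inj: "inj_on F (V \<inter> cball 0 r)"
    and FV: "F ` (V \<inter> cball 0 r) \<subseteq> V" and F0: "F 0 = 0" and z: "z \<in> V"
    and far: "\<And>x. x \<in> V \<Longrightarrow> norm x = r \<Longrightarrow> norm z < norm (F x)"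
  shows "\<exists>x\<in>V \<inter> cball 0 r. F x = z"
proof -
  define S where "S = V \<inter> cball 0 (norm z)"
  have "openin (top_of_set V) (F ` (V \<inter> ball 0 r))"
  proof (rule invariance_of_domain_subspaces[OF _ V V])
    show "openin (top_of_set V) (V \<inter> ball 0 r)"
      by (simp add: openin_open_Int)
    show "continuous_on (V \<inter> ball 0 r) F"
      by (rule continuous_on_subset[OF cont]) auto
    show "F \<in> V \<inter> ball 0 r \<rightarrow> V"
      using FV by (auto simp: image_subset_iff)
    show "inj_on F (V \<inter> ball 0 r)"
      by (rule inj_on_subset[OF inj]) auto
  qed auto
  then have 1: "openin (top_of_set S) (S \<inter> F ` (V \<inter> ball 0 r))"
    by (metis S_def inf.cobounded1 inf_commute openin_subtopology_Int2 subtopology_subtopology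
        subset_refl le_inf_iff openin_subset_trans)
  have "compact (F ` (V \<inter> cball 0 r))"
    using closed_subspace[OF V] cont by (intro compact_continuous_image) auto
  then have "closedin (top_of_set S) (S \<inter> F ` (V \<inter> cball 0 r))"
    by (simp add: closedin_closed_Int compact_imp_closed)
  \<comment> \<open>By \<open>far\<close>, the bounding sphere is mapped outside \<open>S\<close>,
    so within \<open>S\<close> the open and the closed ball have the same image. This makes the
    trace on \<open>S\<close> clopen.\<close>
  moreover have "S \<inter> F ` (V \<inter> cball 0 r) = S \<inter> F ` (V \<inter> ball 0 r)"
    using far by (fastforce simp: S_def)
  ultimately have 2: "closedin (top_of_set S) (S \<inter> F ` (V \<inter> ball 0 r))"
    by simp
  have "0 \<in> V"
    by (simp add: V subspace_0)
  then have 3: "S \<inter> F ` (V \<inter> ball 0 r) \<noteq> {}"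
    using F0 \<open>r > 0\<close> unfolding S_def by (force simp: image_iff)
  have "connected S"
    unfolding S_def by (intro convex_connected convex_Int subspace_imp_convex[OF V]) auto
  then have "S \<inter> F ` (V \<inter> ball 0 r) = S"
    using 1 2 3 unfolding connected_clopen by blast
  then show ?thesis
    using z unfolding S_def by (force simp: image_iff)
qed

text \<open>The points supplied by \<open>near\<close> depend on \<open>e\<close>. Almost nearest
  points of \<open>A n\<close> give one sequence that serves every \<open>e\<close>.\<close>

lemma choose_convergent_sequence:
  fixes p :: "'a::metric_space"
  assumes ne: "\<And>n. A n \<noteq> {}"
    and near: "\<And>e. e > 0 \<Longrightarrow> \<forall>\<^sub>F n in sequentially. \<exists>x\<in>A n. dist p x \<le> e"
  obtains xs where "\<And>n::nat. xs n \<in> A n" "xs \<longlonglongrightarrow> p"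
proof -
  \<comment> \<open>The slack is there because the infimum need not be attained.\<close>
  have "\<exists>x\<in>A n. dist p x < infdist p (A n) + 1 / Suc n" for n
  proof (rule ccontr)
    assume "\<not> ?thesis"
    then have "infdist p (A n) + 1 / Suc n \<le> infdist p (A n)"
      unfolding infdist_notempty[OF ne] by (intro cINF_greatest ne) force
    then show False
      by simp
  qed
  then obtain xs where xs: "\<And>n. xs n \<in> A n" "\<And>n. dist p (xs n) < infdist p (A n) + 1 / Suc n"
    by metis
  have "(\<lambda>n. infdist p (A n)) \<longlonglongrightarrow> 0"
  proof (rule tendstoI)
    fix e :: real
    assume "e > 0"
    then have "\<forall>\<^sub>F n in sequentially. \<exists>x\<in>A n. dist p x \<le> e / 2"
      by (intro near) simp
    then show "\<forall>\<^sub>F n in sequentially. dist (infdist p (A n)) 0 < e"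
    proof eventually_elim
      case (elim n)
      then show ?case
        using infdist_le2[of _ "A n" p "e / 2"] infdist_nonneg[of p "A n"] \<open>e > 0\<close> by fastforce
    qed
  qed
  then have "(\<lambda>n. infdist p (A n) + 1 / Suc n) \<longlonglongrightarrow> 0"
    using tendsto_add[OF _ LIMSEQ_inverse_real_of_nat] by (force simp: inverse_eq_divide)
  then have "(\<lambda>n. dist (xs n) p) \<longlonglongrightarrow> 0"
    by (rule tendsto_0_le[where K = 1])
      (use xs(2) in \<open>force intro!: always_eventually simp: dist_commute less_imp_le abs_of_nonneg infdist_nonneg\<close>)
  then show ?thesis
    using xs(1) that tendsto_dist_iff by blast
qed

text \<open>A change of frame multiplies the determinant by a positive number.\<close>

lemma Grass_det_iff:
  assumes "u \<in> Grass" "M \<in> u" "N \<in> u"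
  shows "det (P ** M) = 0 \<longleftrightarrow> det (P ** N) = 0"
proof -
  obtain M0 where u: "u = oplane_of M0"
    using assms unfolding Grass_def by blast
  have "det (P ** K) = 0 \<longleftrightarrow> det (P ** M0) = 0" if "K \<in> u" for K
    using that unfolding u oplane_of_def by (auto simp: matrix_mul_assoc det_mul)
  then show ?thesis
    using assms by blast
qed

section \<open>Fibrations and their local sections\<close>

lemma fibration_Grass: "fibration \<pi> \<Longrightarrow> \<pi> x \<in> Grass"
  by (simp add: fibration_def)

lemma fibration_meet:
  "fibration \<pi> \<Longrightarrow> w \<in> affp \<pi> x \<Longrightarrow> w \<in> affp \<pi> y \<Longrightarrow> fiber \<pi> x = fiber \<pi> y"
  unfolding fibration_def by blast

lemma mem_affp: "w \<in> affp \<pi> x \<longleftrightarrow> w - x \<in> lin (\<pi> x)"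
  unfolding affp_def by (auto simp: image_iff algebra_simps intro: bexI[of _ "w - x"])

lemma fibration_gconv: "fibration \<pi> \<Longrightarrow> xs \<longlonglongrightarrow> x \<Longrightarrow> gconv (\<lambda>m. \<pi> (xs m)) (\<pi> x)"
  by (simp add: fibration_def)

lemma mem_affp_self: "fibration \<pi> \<Longrightarrow> x \<in> affp \<pi> x"
  by (simp add: mem_affp fibration_Grass subspace_0 subspace_lin)

lemma skew_fibration_common_direction:
  assumes "skew_fibration \<pi>" "v \<in> lin (\<pi> x)" "v \<in> lin (\<pi> y)" "v \<noteq> 0"
  shows "fiber \<pi> x = fiber \<pi> y"
  using assms unfolding skew_fibration_def by blast

text \<open>Near p the fibers are graphs over the fiber through p: up to a choice of basis, P is the
orthogonal projection onto the latter and \<open>C x\<close> its section with values in \<open>lin (\<pi> x)\<close>.\<close>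

lemma fibration_local_section:
  fixes \<pi> :: "real^'n \<Rightarrow> (real^'k^'n) set"
  assumes fib: "fibration \<pi>" and "e > 0"
  obtains P :: "real^'n^'k" and C :: "real^'n \<Rightarrow> real^'k^'n" and r where
    "0 < r" "r \<le> e" "continuous_on (cball p r) C"
    "\<And>x s. x \<in> cball p r \<Longrightarrow> C x *v s \<in> lin (\<pi> x)"
    "\<And>x s. x \<in> cball p r \<Longrightarrow> P *v (C x *v s) = s"
    "\<And>x w. x \<in> cball p r \<Longrightarrow> w \<in> lin (\<pi> x) \<Longrightarrow> C x *v (P *v w) = w"
proof -
  note G = fibration_Grass[OF fib]
  \<comment> \<open>An arbitrary choice of frames, with no continuity in \<open>x\<close>; only
    \<open>C\<close>, which does not depend on the choice, will be continuous.\<close>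
  define rep where "rep x = (SOME M. M \<in> \<pi> x)" for x
  have rep: "rep x \<in> \<pi> x" for x
    unfolding rep_def using Grass_nonempty[OF G] by (simp add: some_in_eq)
  \<comment> \<open>The kernel of this \<open>P\<close> is the orthogonal complement of
    \<open>lin (\<pi> p)\<close>.\<close>
  define P where "P = transpose (rep p)"
  have detp: "det (P ** M) \<noteq> 0" if "M \<in> \<pi> p" for M
    using det_transpose_mult_self_nonzero[OF Grass_inj[OF G rep]] Grass_det_iff[OF G rep that]
    unfolding P_def by blast
  \<comment> \<open>Otherwise degenerate points converge to \<open>p\<close>, and the convergent
    frames given by \<open>gconv\<close> carry the vanishing determinant over to
    \<open>p\<close>.\<close>
  have "\<exists>r. 0 < r \<and> (\<forall>x\<in>cball p r. det (P ** rep x) \<noteq> 0)"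
  proof (rule ccontr)
    assume "\<not> ?thesis"
    then have "\<exists>x. dist p x \<le> 1 / Suc n \<and> det (P ** rep x) = 0" for n
      by (metis mem_cball of_nat_0_less_iff zero_less_Suc zero_less_divide_1_iff)
    then obtain xs where xs: "\<And>n. dist p (xs n) \<le> 1 / Suc n" "\<And>n. det (P ** rep (xs n)) = 0"
      by metis
    have "(\<lambda>n. dist (xs n) p) \<longlonglongrightarrow> 0"
      by (rule tendsto_0_le[OF LIMSEQ_inverse_real_of_nat, where K = 1])
        (use xs(1) in \<open>auto simp: dist_commute inverse_eq_divide\<close>)
    then have "xs \<longlonglongrightarrow> p"
      using tendsto_dist_iff by blast
    then obtain Ms M where Ms: "\<And>m. Ms m \<in> \<pi> (xs m)" "M \<in> \<pi> p" "Ms \<longlonglongrightarrow> M"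
      using fibration_gconv[OF fib] unfolding gconv_def by blast
    have "det (P ** Ms m) = 0" for m
      using Grass_det_iff[OF G rep Ms(1)] xs(2) by blast
    moreover have "(\<lambda>m. det (P ** Ms m)) \<longlonglongrightarrow> det (P ** M)"
      by (intro tendsto_det tendsto_matrix_mult tendsto_const Ms)
    ultimately have "det (P ** M) = 0"
      by (simp add: LIMSEQ_const_iff)
    then show False
      using detp Ms by blast
  qed
  then obtain r where r: "0 < r" and det: "\<And>x. x \<in> cball p r \<Longrightarrow> det (P ** rep x) \<noteq> 0"
    by blast
  define C where "C x = col_section P (rep x)" for x
  \<comment> \<open>Any frame may replace \<open>rep x\<close>, in particular the convergent ones
    from \<open>gconv\<close>; this yields continuity of \<open>C\<close>.\<close>
  have C: "C x = col_section P M" if "x \<in> cball p r" "M \<in> \<pi> x" for x M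
    unfolding C_def using that det Grass_det_iff[OF G that(2) rep]
    by (intro col_section_cong) (simp_all add: Grass_range[OF G, symmetric] rep)
  have "continuous_on (cball p r) C"
  proof (rule continuous_on_sequentiallyI)
    fix xs x
    assume xs: "\<forall>n. xs n \<in> cball p r" and x: "x \<in> cball p r" and "xs \<longlonglongrightarrow> x"
    then obtain Ms M where Ms: "\<And>m. Ms m \<in> \<pi> (xs m)" "M \<in> \<pi> x" "Ms \<longlonglongrightarrow> M"
      using fibration_gconv[OF fib] unfolding gconv_def by blast
    have "det (P ** M) \<noteq> 0"
      using det[OF x] Grass_det_iff[OF G Ms(2) rep] by blast
    then have "(\<lambda>m. col_section P (Ms m)) \<longlonglongrightarrow> col_section P M"
      by (intro tendsto_col_section Ms)
    then show "(\<lambda>n. C (xs n)) \<longlonglongrightarrow> C x"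
      using C[OF x Ms(2)] C[OF _ Ms(1)] xs by simp
  qed
  then have "continuous_on (cball p (min r e)) C"
    by (rule continuous_on_subset) auto
  then show ?thesis
    using that[of "min r e" C P] r \<open>e > 0\<close> det
    by (auto simp: C_def Grass_range[OF G rep] col_section_in_range mult_col_section
        col_section_mult)
qed

text \<open>Write \<open>y m - p\<close> as \<open>C p *v s m + z m\<close>, a part along the fiber
  through \<open>p\<close> and a transverse part. A fiber through \<open>p + x\<close> contains
  \<open>y m\<close> once \<open>F x = z m\<close>, which is solved on the disc
  \<open>V \<inter> cball 0 r\<close>.\<close>

lemma nearby_fiber:
  fixes \<pi> :: "real^'n \<Rightarrow> (real^'k^'n) set"
  assumes skew: "skew_fibration \<pi>" and l: "l \<in> lin (\<pi> p)" "l \<noteq> 0"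
    and y: "filterlim (\<lambda>m. norm (y m)) at_top sequentially"
      "(\<lambda>m. y m /\<^sub>R norm (y m)) \<longlonglongrightarrow> l"
    and "e > 0"
  shows "\<forall>\<^sub>F m in sequentially. \<exists>x. \<pi> x = \<pi> (y m) \<and> dist p x \<le> e"
proof -
  have fib: "fibration \<pi>"
    using skew by (simp add: skew_fibration_def)
  obtain P :: "real^'n^'k" and C r where r: "0 < r" "r \<le> e"
    and cont: "continuous_on (cball p r) C"
    and C_lin: "\<And>x s. x \<in> cball p r \<Longrightarrow> C x *v s \<in> lin (\<pi> x)"
    and PC: "\<And>x s. x \<in> cball p r \<Longrightarrow> P *v (C x *v s) = s"
    and CP: "\<And>x w. x \<in> cball p r \<Longrightarrow> w \<in> lin (\<pi> x) \<Longrightarrow> C x *v (P *v w) = w"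
    using fibration_local_section[OF fib \<open>e > 0\<close>] by metis
  define V where "V = {x. P *v x = 0}"
  have V: "subspace V"
    unfolding V_def by (auto simp: subspace_def matrix_vector_right_distrib matrix_vector_mult_scaleR)
  have p: "p \<in> cball p r" and px: "p + x \<in> cball p r \<longleftrightarrow> x \<in> cball 0 r" for x
    using r by (auto simp: dist_norm)
  \<comment> \<open>Transversality: \<open>V\<close> meets the direction of every nearby fiber only
    in 0.\<close>
  have V_lin: "v = 0" if "v \<in> V" "x \<in> cball p r" "v \<in> lin (\<pi> x)" for v x
    using CP[of x v] that by (simp add: V_def)
  \<comment> \<open>\<open>D x\<close> is the tilt of the fiber through \<open>p + x\<close> against
    the one through \<open>p\<close>; it is not the disc of the overview.\<close>
  define D where "D x = C (p + x) - C p" for x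
  have D_mult: "D x *v s = C (p + x) *v s - C p *v s" for x s
    by (simp add: D_def matrix_vector_mult_diff_rdistrib)
  have contD: "continuous_on (cball 0 r) D"
    unfolding D_def
    by (intro continuous_intros continuous_on_compose2[OF cont]) (auto simp: dist_norm)
  interpret mv: bounded_bilinear "(*v) :: real^'k^'n \<Rightarrow> real^'k \<Rightarrow> real^'n"
    by (rule bounded_bilinear_matrix_vector_mult)
  define a where "a = P *v l"
  have Ca: "C p *v a = l"
    using CP[OF p l(1)] by (simp add: a_def)
  \<comment> \<open>Skewness enters here: without tilt in direction \<open>a\<close>, the fibers
    through \<open>p\<close> and \<open>p + x\<close> would share \<open>l\<close> and coincide,
    against transversality.\<close>
  have Da: "D x *v a \<noteq> 0" if "x \<in> V" "norm x = r" for x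
  proof
    assume "D x *v a = 0"
    then have "C (p + x) *v a = l"
      using D_mult Ca by simp
    moreover have "p + x \<in> cball p r"
      using px that by simp
    ultimately have "l \<in> lin (\<pi> (p + x))"
      using C_lin by metis
    then have "fiber \<pi> (p + x) = fiber \<pi> p"
      using skew_fibration_common_direction[OF skew _ l(1)] l(2) by blast
    then have "x \<in> lin (\<pi> p)"
      using mem_affp_self[OF fib, of "p + x"] by (simp add: fiber_def mem_affp)
    then show False
      using V_lin[OF _ p] that r by auto
  qed
  obtain c where c: "c > 0" "\<And>x. x \<in> V \<Longrightarrow> norm x = r \<Longrightarrow> c \<le> norm (D x *v a)"
  proof (cases "V \<inter> sphere 0 r = {}")
    \<comment> \<open>Here \<open>V\<close> is trivial, the fibers fill the whole space, and any
      positive \<open>c\<close> will do.\<close>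
    case True
    then have "norm x \<noteq> r" if "x \<in> V" for x
      using that by auto
    then show ?thesis
      using that[of 1] by force
  next
    case False
    moreover have "compact (V \<inter> sphere 0 r)"
      using closed_subspace[OF V] by (simp add: closed_Int_compact)
    moreover have "continuous_on (V \<inter> sphere 0 r) (\<lambda>x. norm (D x *v a))"
      by (intro continuous_intros mv.continuous_on continuous_on_subset[OF contD]) auto
    ultimately obtain x where "x \<in> V \<inter> sphere 0 r"
      "\<forall>x'\<in>V \<inter> sphere 0 r. norm (D x *v a) \<le> norm (D x' *v a)"
      using continuous_attains_inf by metis
    then show ?thesis
      using that[of "norm (D x *v a)"] Da by auto
  qed
  obtain B where B: "\<And>x s. x \<in> cball 0 r \<Longrightarrow> norm (D x *v s) \<le> B * norm s"
  proof -
    have "bounded (D ` cball 0 r)"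
      by (intro compact_imp_bounded compact_continuous_image contD) auto
    then obtain b where b: "\<And>x. x \<in> cball 0 r \<Longrightarrow> norm (D x) \<le> b"
      unfolding bounded_iff by blast
    obtain K where K: "K > 0" "\<And>A s. norm ((A :: real^'k^'n) *v s) \<le> norm A * norm s * K"
      using mv.pos_bounded by blast
    have "norm (D x *v s) \<le> b * K * norm s" if "x \<in> cball 0 r" for x s
    proof -
      have "norm (D x *v s) \<le> norm (D x) * (norm s * K)"
        using K(2)[of "D x" s] by (simp add: mult.assoc)
      also have "\<dots> \<le> b * (norm s * K)"
        using b[OF that] K(1) by (intro mult_right_mono) auto
      finally show ?thesis
        by (simp add: algebra_simps)
    qed
    then show ?thesis
      using that by blast
  qed
  define T where "T m = norm (y m)" for m
  define s where "s m = P *v (y m - p)" for m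
  define z where "z m = y m - p - C p *v s m" for m
  \<comment> \<open>The deviation of the rescaled fiber coordinate from its limit \<open>a\<close>,
    the coordinate of \<open>l\<close>.\<close>
  define \<delta> where "\<delta> m = s m /\<^sub>R T m - a" for m
  have T: "filterlim T at_top sequentially"
    using y(1) by (simp add: T_def[abs_def])
  have "(\<lambda>m. p /\<^sub>R T m) \<longlonglongrightarrow> 0"
    using tendsto_scaleR[OF tendsto_inverse_0_at_top[OF T] tendsto_const, of p] by simp
  from tendsto_diff[OF y(2) this] have yp: "(\<lambda>m. (y m - p) /\<^sub>R T m) \<longlonglongrightarrow> l"
    by (simp add: T_def scaleR_diff_right)
  have "(\<lambda>m. P *v ((y m - p) /\<^sub>R T m)) \<longlonglongrightarrow> a"
    unfolding a_def by (intro tendsto_matrix_vector_mult tendsto_const yp)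
  then have sT: "(\<lambda>m. s m /\<^sub>R T m) \<longlonglongrightarrow> a"
    by (simp add: s_def matrix_vector_mult_scaleR)
  then have "\<delta> \<longlonglongrightarrow> 0"
    unfolding \<delta>_def using LIM_zero by blast
  then have B\<delta>: "(\<lambda>m. B * norm (\<delta> m)) \<longlonglongrightarrow> 0"
    by (auto intro: tendsto_mult_right_zero tendsto_norm_zero)
  have "(\<lambda>m. (y m - p) /\<^sub>R T m - C p *v (s m /\<^sub>R T m)) \<longlonglongrightarrow> l - C p *v a"
    by (intro tendsto_diff yp tendsto_matrix_vector_mult tendsto_const sT)
  then have "(\<lambda>m. z m /\<^sub>R T m) \<longlonglongrightarrow> 0"
    by (simp add: z_def Ca matrix_vector_mult_scaleR scaleR_diff_right)
  then have zT: "(\<lambda>m. norm (z m /\<^sub>R T m)) \<longlonglongrightarrow> 0"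
    by (rule tendsto_norm_zero)
  \<comment> \<open>The budget in units of \<open>T m\<close>: on the bounding sphere the main term
    of \<open>F x\<close> is at least \<open>c\<close>, the radius \<open>r\<close> and the
    \<open>\<delta>\<close> error cost at most \<open>c / 4\<close> each, and \<open>z m\<close>
    stays below \<open>c / 4\<close>.\<close>
  have "c / 4 > 0"
    using c by simp
  note ev = order_tendstoD(2)[OF B\<delta> this] order_tendstoD(2)[OF zT this]
  have "\<forall>\<^sub>F m in sequentially. 4 * r / c < T m"
    using T by (simp add: filterlim_at_top_dense)
  then show ?thesis
    using ev
  proof eventually_elim
    case (elim m)
    have "0 < 4 * r / c"
      using r c by simp
    then have Tpos: "T m > 0"
      using elim(1) by linarith
    have "r < T m * (c / 4)"
      using elim(1) c by (simp add: field_simps)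
    have s_eq: "s m = T m *\<^sub>R a + T m *\<^sub>R \<delta> m"
      using Tpos by (simp add: \<delta>_def scaleR_diff_right)
    \<comment> \<open>The sliding map: the fiber through \<open>p + x\<close> meets the translate of
      \<open>V\<close> through \<open>p + C p *v s m\<close> at offset \<open>F x\<close>.\<close>
    define F where "F x = x + D x *v s m" for x
    have F_affp: "p + C p *v s m + F x \<in> affp \<pi> (p + x)" if "x \<in> cball 0 r" for x
    proof -
      have "p + x \<in> cball p r"
        using px that by blast
      from C_lin[OF this, of "s m"] show ?thesis
        by (simp add: F_def D_mult mem_affp)
    qed
    have z_less: "norm (z m) < T m * (c / 4)"
      using elim(3) Tpos by (simp add: field_simps)
    have "\<exists>x\<in>V \<inter> cball 0 r. F x = z m"
    proof (rule inj_ball_image_covers[OF V \<open>0 < r\<close>])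
      show "continuous_on (V \<inter> cball 0 r) F"
        unfolding F_def
        by (intro continuous_intros mv.continuous_on continuous_on_subset[OF contD]) auto
      show "inj_on F (V \<inter> cball 0 r)"
      proof (rule inj_onI)
        fix x x'
        assume x: "x \<in> V \<inter> cball 0 r" and x': "x' \<in> V \<inter> cball 0 r" and "F x = F x'"
        \<comment> \<open>Equal values make the two fibers meet, hence coincide; then
          \<open>x' - x\<close> lies in \<open>V\<close> and in their common direction.\<close>
        then have "fiber \<pi> (p + x) = fiber \<pi> (p + x')"
          using fibration_meet[OF fib] F_affp by (metis IntD2)
        then have "p + x' \<in> affp \<pi> (p + x)"
          using mem_affp_self[OF fib, of "p + x'"] by (simp add: fiber_def)
        then have "x' - x \<in> lin (\<pi> (p + x))"
          by (simp add: mem_affp)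
        then have "x' - x = 0"
          using V_lin[of "x' - x" "p + x"] x x' px subspace_diff[OF V] by blast
        then show "x = x'"
          by simp
      qed
      show "F ` (V \<inter> cball 0 r) \<subseteq> V"
        using PC px p
        by (auto simp: F_def D_mult V_def matrix_vector_right_distrib matrix_vector_mult_diff_distrib)
      show "F 0 = 0"
        by (simp add: F_def D_def)
      show "z m \<in> V"
        using PC[OF p] by (simp add: V_def z_def matrix_vector_mult_diff_distrib s_def)
    next
      fix x
      assume x: "x \<in> V" "norm x = r"
      \<comment> \<open>Splitting \<open>s m\<close> isolates the main term, of norm at least
        \<open>T m * c\<close>.\<close>
      have F_eq: "F x = T m *\<^sub>R (D x *v a) + (x + T m *\<^sub>R (D x *v \<delta> m))"
        by (simp add: F_def s_eq matrix_vector_right_distrib matrix_vector_mult_scaleR)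
      have "norm (D x *v \<delta> m) \<le> c / 4"
        using B[of x "\<delta> m"] x elim(2) by simp
      then have "norm (T m *\<^sub>R (D x *v \<delta> m)) \<le> T m * (c / 4)"
        using Tpos by simp
      moreover have "T m * c \<le> norm (T m *\<^sub>R (D x *v a))"
        using c(2)[OF x] Tpos by simp
      moreover have "norm (T m *\<^sub>R (D x *v a)) \<le> norm (F x) + (norm x + norm (T m *\<^sub>R (D x *v \<delta> m)))"
        unfolding F_eq using norm_triangle_ineq4[of "F x" "x + T m *\<^sub>R (D x *v \<delta> m)"]
          norm_triangle_ineq[of x "T m *\<^sub>R (D x *v \<delta> m)"] unfolding F_eq by simp
      moreover have "T m * c = 4 * (T m * (c / 4))"
        by simp
      ultimately show "norm (z m) < norm (F x)"
        using z_less \<open>r < T m * (c / 4)\<close> x(2) \<open>0 < r\<close> by linarith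
    qed
    then obtain x where x: "x \<in> cball 0 r" "F x = z m"
      by blast
    \<comment> \<open>By definition of \<open>z m\<close>, the point
      \<open>p + C p *v s m + z m\<close> is \<open>y m\<close>.\<close>
    then have "y m \<in> affp \<pi> (p + x)"
      using F_affp[of x] by (simp add: z_def)
    then have "fiber \<pi> (p + x) = fiber \<pi> (y m)"
      using fibration_meet[OF fib] mem_affp_self[OF fib] by blast
    then show ?case
      using x r by (intro exI[of _ "p + x"]) (simp add: fiber_def dist_norm)
  qed
qed

theorem theorem4p2:
  fixes \<pi> :: "real^'n \<Rightarrow> (real^'k^'n) set"
    and l :: "real^'n"
    and y :: "nat \<Rightarrow> real^'n"
  assumes "skew_fibration \<pi>"
    and "l \<in> Lset \<pi>"
    and "filterlim (\<lambda>m. norm (y m)) at_top sequentially"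
    and "(\<lambda>m. y m /\<^sub>R norm (y m)) \<longlonglongrightarrow> l"
  shows "gconv (\<lambda>m. \<pi> (y m)) (iota \<pi> l)"
proof -
  obtain p where p: "l \<in> lin (\<pi> p)" "l \<noteq> 0"
    using assms(2) unfolding Lset_def by fastforce
  \<comment> \<open>Skewness makes the plane containing \<open>l\<close> unique, so
    \<open>THE\<close> in \<open>iota\<close> is well defined.\<close>
  have "u = \<pi> p" if "u \<in> range \<pi>" "l \<in> lin u" for u
    using that skew_fibration_common_direction[OF assms(1) _ p(1)] p(2)
    by (auto simp: fiber_def)
  then have iota: "iota \<pi> l = \<pi> p"
    unfolding iota_def using p(1) by (intro the_equality) auto
  \<comment> \<open>A sequence in these sets converging to \<open>p\<close> has the same directions
    as \<open>y\<close>, so continuity of \<open>\<pi>\<close> at \<open>p\<close> gives the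
    claim.\<close>
  define A where "A m = {x. \<pi> x = \<pi> (y m)}" for m
  have ne: "A m \<noteq> {}" for m
    unfolding A_def by blast
  have near: "\<forall>\<^sub>F m in sequentially. \<exists>x\<in>A m. dist p x \<le> e" if "e > 0" for e
    using nearby_fiber[OF assms(1) p assms(3,4) that] by (simp add: A_def)
  obtain xs where xs: "\<And>m. xs m \<in> A m" "xs \<longlonglongrightarrow> p"
    using choose_convergent_sequence[OF ne near] by blast
  have "fibration \<pi>"
    using assms(1) by (simp add: skew_fibration_def)
  from fibration_gconv[OF this xs(2)] show ?thesis
    using xs(1) iota by (simp add: A_def)
qed

end
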